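(* Let $L\ge 1$ be an integer, $S=L+1$, and $b_0\in\mathbb{R}$. Let $\boldsymbol{\delta}^A,\boldsymbol{\delta}^B\in\mathbb{R}^L$ and let $\mathbf{z}^A=\Phi_{b_0}\boldsymbol{\delta}^A\in\mathbb{R}^S$ and $\mathbf{z}^B=\Phi_{b_0}\boldsymbol{\delta}^B\in\mathbb{R}^S$, where $\Phi_{b_0}\in\mathbb{R}^{S\times L}$ is the wavelet response operator at position $b_0$; assume $\mathbf{z}^A\neq 0$ and $\mathbf{z}^B\neq 0$. Define $\hat{\mathbf{z}}^A,\hat{\mathbf{z}}^B\in\mathbb{R}^S$ by $\hat z_j^A=(z_j^A)^2/\|\mathbf{z}^A\|_2^2$ and $\hat z_j^B=(z_j^B)^2/\|\mathbf{z}^B\|_2^2$ for $j=1,\dots,S$. If $\hat{\mathbf{z}}^A\prec\hat{\mathbf{z}}^B$ (that is, $\hat{\mathbf{z}}^A$ is majorized by $\hat{\mathbf{z}}^B$) and $\hat{\mathbf{z}}^A$ is not a permutation of $\hat{\mathbf{z}}^B$, then $$H(\mathrm{scale}\mid b_0)^A>H(\mathrm{scale}\mid b_0)^B,$$ where $H(\mathrm{scale}\mid b_0)^A$ and $H(\mathrm{scale}\mid b_0)^B$ are the conditional scale entropies at $b_0$ associated with $\boldsymbol{\delta}^A$ and $\boldsymbol{\delta}^B$ respectively.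
   Context: Wavelet response operator. Let $\psi(t)=e^{-t^2/2}\cos(\omega_0 t)$ with $\omega_0=5$ (real Morlet wavelet), scales $a_j=j$ for $j=1,\dots,S$, and $h_l(t)=\min(\max(t-l,0),1)$ for $l=0,\dots,L-1$. The matrix $\Phi_{b_0}\in\mathbb{R}^{S\times L}$ has entries $$(\Phi_{b_0})_{j,l}=\frac{1}{\sqrt{a_j}}\int_{-\infty}^{\infty}h_l(t)\,\psi\!\left(\frac{t-b_0}{a_j}\right)dt .$$ Conditional scale distribution and entropy. For $\boldsymbol{\delta}\in\mathbb{R}^L$ with $\mathbf{z}=\Phi_{b_0}\boldsymbol{\delta}\neq 0$, the conditional scale distribution at $b_0$ is $p(a_j\mid b_0)=z_j^2/\|\mathbf{z}\|_2^2$ for $j=1,\dots,S$, and the conditional scale entropy is $$H(\mathrm{scale}\mid b_0)=-\sum_{j=1}^{S}p(a_j\mid b_0)\log p(a_j\mid b_0),$$ with $\log$ the natural logarithm and $0\log 0:=0$. A superscript $A$ or $B$ indicates that $\boldsymbol{\delta}=\boldsymbol{\delta}^A$ or $\boldsymbol{\delta}=\boldsymbol{\delta}^B$. Majorization. For $\mathbf{p},\mathbf{q}\in\mathbb{R}^S$, with $p_{[1]}\ge\cdots\ge p_{[S]}$ and $q_{[1]}\ge\cdots\ge q_{[S]}$ their entries sorted in decreasing order, $\mathbf{p}\prec\mathbf{q}$ means $\sum_{j=1}^k p_{[j]}\le\sum_{j=1}^k q_{[j]}$ for $k=1,\dots,S-1$, with equality for $k=S$. *)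

theory Defs
  imports
    "HOL-Analysis.Lebesgue_Measure"
    "HOL-Analysis.L2_Norm"
    "HOL-Combinatorics.Permutations"
    "Jordan_Normal_Form.Matrix"
begin

definition morlet :: "real \<Rightarrow> real" where
  "morlet t = exp (- (t\<^sup>2 / 2)) * cos (5 * t)"

(* Row and vector indices start at 0, so row i carries the scale a_(i+1) = i + 1. *)
definition wscale :: "nat \<Rightarrow> real" where
  "wscale i = real (i + 1)"

definition hinge :: "nat \<Rightarrow> real \<Rightarrow> real" where
  "hinge l t = min (max (t - real l) 0) 1"

(* The hinge is bounded and the wavelet has Gaussian decay, so every entry is an
   absolutely convergent integral. *)
definition wavelet_response :: "nat \<Rightarrow> nat \<Rightarrow> real \<Rightarrow> real mat" where
  "wavelet_response S L b0 = mat S L (\<lambda>(i, l).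
     1 / sqrt (wscale i) * (LINT t|lborel. hinge l t * morlet ((t - b0) / wscale i)))"

definition norm2 :: "real vec \<Rightarrow> real" where
  "norm2 z = L2_set (\<lambda>i. z $ i) {..<dim_vec z}"

definition cond_scale_dist :: "nat \<Rightarrow> nat \<Rightarrow> real \<Rightarrow> real vec \<Rightarrow> real vec" where
  "cond_scale_dist S L b0 d =
     (let z = wavelet_response S L b0 *\<^sub>v d in vec S (\<lambda>i. (z $ i)\<^sup>2 / (norm2 z)\<^sup>2))"

(* The convention 0 log 0 = 0 is automatic, as the factor 0 makes the product vanish. *)
definition cond_scale_entropy :: "nat \<Rightarrow> nat \<Rightarrow> real \<Rightarrow> real vec \<Rightarrow> real" where
  "cond_scale_entropy S L b0 d =
     - (\<Sum>i<S. cond_scale_dist S L b0 d $ i * ln (cond_scale_dist S L b0 d $ i))"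

definition sorted_desc :: "real vec \<Rightarrow> real list" where
  "sorted_desc p = rev (sort (list_of_vec p))"

definition majorized_by :: "real vec \<Rightarrow> real vec \<Rightarrow> bool" where
  "majorized_by p q \<longleftrightarrow> dim_vec p = dim_vec q \<and>
     (\<forall>k\<in>{1..<dim_vec q}. (\<Sum>j<k. sorted_desc p ! j) \<le> (\<Sum>j<k. sorted_desc q ! j)) \<and>
     (\<Sum>j<dim_vec q. sorted_desc p ! j) = (\<Sum>j<dim_vec q. sorted_desc q ! j)"

definition permutation_of :: "real vec \<Rightarrow> real vec \<Rightarrow> bool" where
  "permutation_of p q \<longleftrightarrow> dim_vec p = dim_vec q \<and>
     (\<exists>\<pi>. \<pi> permutes {..<dim_vec q} \<and> (\<forall>i<dim_vec q. p $ i = q $ \<pi> i))"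

end

theory Submission
  imports Defs
begin

text \<open>
  With both distributions sorted decreasingly as \<open>x\<close> and \<open>y\<close>, strict convexity of \<open>t ln t\<close> gives
  \<open>y\<^sub>i ln y\<^sub>i - x\<^sub>i ln x\<^sub>i \<ge> (ln x\<^sub>i + 1) (y\<^sub>i - x\<^sub>i)\<close>, strictly unless \<open>x\<^sub>i = y\<^sub>i\<close>. The tangent slopes
  decrease in \<open>i\<close> and the partial sums of \<open>y - x\<close> are nonnegative with total zero, so summation by
  parts makes the right-hand sides sum to something nonnegative. The tangent is vertical where
  \<open>x\<^sub>i = 0\<close>, but majorization forces \<open>y\<^sub>i = 0\<close> there.
\<close>

text \<open>For \<open>y > 0\<close> the gap between the two sides is
  \<open>y * (r - 1 - ln r)\<close> with \<open>r = x / y\<close>, positive because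
  \<open>ln r < r - 1\<close> for \<open>r \<noteq> 1\<close>. For \<open>y = 0\<close> the gap is
  \<open>x\<close>.\<close>

lemma tangent_x_ln_x_strict:
  fixes x y :: real
  assumes "x > 0" "y \<ge> 0" "x \<noteq> y"
  shows "(ln x + 1) * (y - x) < y * ln y - x * ln x"
proof (cases "y = 0")
  case True
  then show ?thesis using assms by (simp add: algebra_simps)
next
  case False
  then have y: "y > 0" using assms by simp
  then have "ln (x / y) < x / y - 1"
    using assms ln_le_minus_one[of "x / y"] ln_eq_minus_one[of "x / y"] by fastforce
  then have "y * ln (x / y) < y * (x / y - 1)"
    using y by simp
  then show ?thesis
    using y assms by (simp add: ln_div algebra_simps)
qed

text \<open>Summation by parts as an induction: lowering the coefficient of a nonnegative partial
  sum from \<open>c k\<close> to \<open>c (Suc k)\<close> can only decrease the product. The full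
  sum up to \<open>k\<close> may have either sign; in the application it is zero, so the lower bound
  vanishes.\<close>

lemma sum_mult_ge_last_mult_sum:
  fixes c d :: "nat \<Rightarrow> real"
  assumes "\<And>i j. i \<le> j \<Longrightarrow> j \<le> k \<Longrightarrow> c j \<le> c i"
    and "\<And>j. j \<le> k \<Longrightarrow> 0 \<le> (\<Sum>i<j. d i)"
  shows "c k * (\<Sum>i\<le>k. d i) \<le> (\<Sum>i\<le>k. c i * d i)"
  using assms
proof (induction k)
  case (Suc k)
  have "c (Suc k) * (\<Sum>i\<le>k. d i) \<le> c k * (\<Sum>i\<le>k. d i)"
    using Suc.prems(1)[of k "Suc k"] Suc.prems(2)[of "Suc k"]
    by (intro mult_right_mono) (auto simp: lessThan_Suc_atMost)
  also have "\<dots> \<le> (\<Sum>i\<le>k. c i * d i)"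
    by (rule Suc.IH) (use Suc.prems in auto)
  finally show ?case by (simp add: algebra_simps)
qed simp

lemma majorization_sum_x_ln_x_less:
  fixes x y :: "nat \<Rightarrow> real"
  assumes desc: "\<And>i j. i \<le> j \<Longrightarrow> j < n \<Longrightarrow> x j \<le> x i"
    and x: "\<And>i. i < n \<Longrightarrow> 0 \<le> x i" and y: "\<And>i. i < n \<Longrightarrow> 0 \<le> y i"
    and part: "\<And>k. k \<le> n \<Longrightarrow> (\<Sum>i<k. x i) \<le> (\<Sum>i<k. y i)"
    and total: "(\<Sum>i<n. x i) = (\<Sum>i<n. y i)"
    and neq: "\<exists>i<n. x i \<noteq> y i"
  shows "(\<Sum>i<n. x i * ln (x i)) < (\<Sum>i<n. y i * ln (y i))"
proof -
  \<comment> \<open>The positive entries of \<open>x\<close> are exactly those below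
    \<open>m\<close>; the disjunct \<open>i = n\<close> covers the case where all are
    positive.\<close>
  define m where "m = (LEAST i. i = n \<or> x i \<le> 0)"
  have "m = n \<or> x m \<le> 0" unfolding m_def by (rule LeastI[of _ n]) simp
  have mn: "m \<le> n" unfolding m_def by (rule Least_le) simp
  have pos: "x i > 0" if "i < m" for i
    using not_less_Least[of i "\<lambda>i. i = n \<or> x i \<le> 0"] that by (auto simp: m_def)
  have x0: "x i = 0" if "m \<le> i" "i < n" for i
    using \<open>m = n \<or> x m \<le> 0\<close> that desc[of m i] x[of i] by auto
  have split: "(\<Sum>i<n. f i) = (\<Sum>i<m. f i) + (\<Sum>i=m..<n. f i)" for f :: "nat \<Rightarrow> real"
    using sum.atLeastLessThan_concat[of 0 m n f] mn by (simp add: lessThan_atLeast0)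
  have sx: "(\<Sum>i=m..<n. x i) = 0" using x0 by simp
  \<comment> \<open>With equal totals, the partial sum inequality at \<open>m\<close> bounds the
    tail of \<open>y\<close> by the tail of \<open>x\<close>, which is zero.\<close>
  have "(\<Sum>i=m..<n. y i) \<ge> 0" using y by (intro sum_nonneg) auto
  then have sy: "(\<Sum>i=m..<n. y i) = 0" and sm: "(\<Sum>i<m. x i) = (\<Sum>i<m. y i)"
    using part[OF mn] total sx unfolding split by linarith+
  have y0: "y i = 0" if "m \<le> i" "i < n" for i
    using sy that y by (subst (asm) sum_nonneg_eq_0_iff) auto
  \<comment> \<open>Both tails vanish, so a difference must lie below \<open>m\<close>. Hence
    \<open>m > 0\<close>, and \<open>k\<close> is the last index with a finite tangent
    slope.\<close>
  obtain i0 where i0: "i0 < m" "x i0 \<noteq> y i0"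
    using neq x0 y0 by (metis not_le)
  then obtain k where k: "m = Suc k" by (cases m) auto
  have "(ln (x k) + 1) * (\<Sum>i\<le>k. y i - x i) \<le> (\<Sum>i\<le>k. (ln (x i) + 1) * (y i - x i))"
  proof (rule sum_mult_ge_last_mult_sum)
    show "ln (x j) + 1 \<le> ln (x i) + 1" if "i \<le> j" "j \<le> k" for i j
      using that desc[of i j] pos[of i] pos[of j] mn k by simp
    show "0 \<le> (\<Sum>i<j. y i - x i)" if "j \<le> k" for j
      using part[of j] that mn k by (simp add: sum_subtractf)
  qed
  then have "0 \<le> (\<Sum>i<m. (ln (x i) + 1) * (y i - x i))"
    using sm by (simp add: k lessThan_Suc_atMost sum_subtractf)
  also have "\<dots> < (\<Sum>i<m. y i * ln (y i) - x i * ln (x i))"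
  proof (rule sum_strict_mono_ex1)
    have strict: "(ln (x i) + 1) * (y i - x i) < y i * ln (y i) - x i * ln (x i)"
      if "i < m" "x i \<noteq> y i" for i
      using tangent_x_ln_x_strict[of "x i" "y i"] pos[of i] y[of i] that mn by auto
    show "\<forall>i\<in>{..<m}. (ln (x i) + 1) * (y i - x i) \<le> y i * ln (y i) - x i * ln (x i)"
    proof
      fix i assume "i \<in> {..<m}"
      then show "(ln (x i) + 1) * (y i - x i) \<le> y i * ln (y i) - x i * ln (x i)"
        using strict[of i] by (cases "x i = y i") auto
    qed
    show "\<exists>i\<in>{..<m}. (ln (x i) + 1) * (y i - x i) < y i * ln (y i) - x i * ln (x i)"
      using strict i0 by blast
  qed simp
  \<comment> \<open>The tails add only terms \<open>0 * ln 0 = 0\<close>.\<close>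
  finally show ?thesis
    using x0 y0 by (simp add: split sum_subtractf)
qed

lemma length_sorted_desc [simp]: "length (sorted_desc p) = dim_vec p"
  by (simp add: sorted_desc_def)

lemma mset_sorted_desc [simp]: "mset (sorted_desc p) = mset (list_of_vec p)"
  by (simp add: sorted_desc_def)

lemma sorted_desc_antimono:
  assumes "i \<le> j" "j < dim_vec p"
  shows "sorted_desc p ! j \<le> sorted_desc p ! i"
  using sorted_rev_nth_mono[of "sorted_desc p" i j] assms by (simp add: sorted_desc_def)

text \<open>Such a sum depends only on the multiset of entries, which sorting preserves.\<close>

lemma sum_sorted_desc:
  fixes f :: "real \<Rightarrow> real"
  shows "(\<Sum>i<dim_vec p. f (sorted_desc p ! i)) = (\<Sum>i<dim_vec p. f (p $ i))"
proof -
  have *: "(\<Sum>i<length xs. f (xs ! i)) = sum_mset (image_mset f (mset xs))" for xs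
    using sum_list_sum_nth[of "map f xs"]
    by (simp add: lessThan_atLeast0 sum_mset_sum_list flip: mset_map)
  have "(\<Sum>i<dim_vec p. f (p $ i)) = (\<Sum>i<dim_vec p. f (list_of_vec p ! i))"
    by (simp add: list_of_vec_index)
  then show ?thesis
    using *[of "sorted_desc p"] *[of "list_of_vec p"] by simp
qed

lemma sorted_desc_nonneg:
  assumes "\<And>i. i < dim_vec p \<Longrightarrow> 0 \<le> p $ i" "j < dim_vec p"
  shows "0 \<le> sorted_desc p ! j"
proof -
  have "sorted_desc p ! j \<in> set (sorted_desc p)" using assms by simp
  also have "\<dots> = set (list_of_vec p)" by (simp add: sorted_desc_def)
  finally show ?thesis
    using assms(1) by (metis in_set_conv_nth length_list_of_vec list_of_vec_index)
qed

text \<open>Equal sorted lists come from equal multisets of entries, and lists with equal multisets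
  differ by a permutation of positions. The contrapositive supplies an index where the sorted
  sequences differ.\<close>

lemma permutation_of_if_sorted_desc_eq:
  assumes "sorted_desc p = sorted_desc q"
  shows "permutation_of p q"
proof -
  have m: "mset (list_of_vec p) = mset (list_of_vec q)"
    using assms by (metis mset_sorted_desc)
  then obtain \<pi> where \<pi>: "\<pi> permutes {..<dim_vec q}"
      "permute_list \<pi> (list_of_vec q) = list_of_vec p"
    using mset_eq_permutation[OF m] by auto
  have d: "dim_vec p = dim_vec q" using assms by (metis length_sorted_desc)
  have "p $ i = q $ \<pi> i" if "i < dim_vec q" for i
  proof -
    have "\<pi> i < dim_vec q" using permutes_in_image[OF \<pi>(1)] that by auto
    then have "list_of_vec p ! i = list_of_vec q ! \<pi> i"
      using permute_list_nth[of \<pi> "list_of_vec q" i] \<pi> that by simp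
    then show ?thesis
      using that d \<open>\<pi> i < dim_vec q\<close> by (simp add: list_of_vec_index)
  qed
  then show ?thesis
    using d \<pi>(1) by (auto simp: permutation_of_def)
qed

lemma majorized_by_sum_x_ln_x_less:
  assumes maj: "majorized_by p q" and perm: "\<not> permutation_of p q"
    and p: "\<And>i. i < dim_vec p \<Longrightarrow> 0 \<le> p $ i" and q: "\<And>i. i < dim_vec q \<Longrightarrow> 0 \<le> q $ i"
  shows "(\<Sum>i<dim_vec p. p $ i * ln (p $ i)) < (\<Sum>i<dim_vec q. q $ i * ln (q $ i))"
proof -
  have d: "dim_vec p = dim_vec q" using maj by (simp add: majorized_by_def)
  have "sorted_desc p \<noteq> sorted_desc q"
    using perm permutation_of_if_sorted_desc_eq by blast
  then have neq: "\<exists>i<dim_vec q. sorted_desc p ! i \<noteq> sorted_desc q ! i"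
    using d by (auto simp: list_eq_iff_nth_eq)
  have total: "(\<Sum>i<dim_vec q. sorted_desc p ! i) = (\<Sum>i<dim_vec q. sorted_desc q ! i)"
    using maj by (simp add: majorized_by_def)
  have part: "(\<Sum>i<k. sorted_desc p ! i) \<le> (\<Sum>i<k. sorted_desc q ! i)" if "k \<le> dim_vec q" for k
  \<comment> \<open>Majorization gives the inequality only for \<open>1 \<le> k < dim_vec q\<close>;
    the endpoints are the empty sum and the equality of totals.\<close>
  proof (cases "k = 0 \<or> k = dim_vec q")
    case True
    then show ?thesis using total by auto
  next
    case False
    then show ?thesis using maj that by (simp add: majorized_by_def)
  qed
  have "(\<Sum>i<dim_vec q. sorted_desc p ! i * ln (sorted_desc p ! i))
      < (\<Sum>i<dim_vec q. sorted_desc q ! i * ln (sorted_desc q ! i))"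
    by (rule majorization_sum_x_ln_x_less)
      (use d sorted_desc_antimono sorted_desc_nonneg p q part total neq in auto)
  then show ?thesis
    using sum_sorted_desc[of "\<lambda>t. t * ln t" p] sum_sorted_desc[of "\<lambda>t. t * ln t" q] d by simp
qed

theorem theorem2:
  fixes L S :: nat and b0 :: real
    and deltaA deltaB zA zB zhatA zhatB :: "real vec"
  assumes "L \<ge> 1" and "S = L + 1"
    and "deltaA \<in> carrier_vec L" and "deltaB \<in> carrier_vec L"
    and "zA = wavelet_response S L b0 *\<^sub>v deltaA"
    and "zB = wavelet_response S L b0 *\<^sub>v deltaB"
    and "zA \<noteq> 0\<^sub>v S" and "zB \<noteq> 0\<^sub>v S"
    and "zhatA = vec S (\<lambda>i. (zA $ i)\<^sup>2 / (norm2 zA)\<^sup>2)"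
    and "zhatB = vec S (\<lambda>i. (zB $ i)\<^sup>2 / (norm2 zB)\<^sup>2)"
    and "majorized_by zhatA zhatB"
    and "\<not> permutation_of zhatA zhatB"
  shows "cond_scale_entropy S L b0 deltaA > cond_scale_entropy S L b0 deltaB"
proof -
  have dist: "cond_scale_dist S L b0 deltaA = zhatA" "cond_scale_dist S L b0 deltaB = zhatB"
    by (simp_all add: cond_scale_dist_def Let_def assms(5,6,9,10))
  have dim: "dim_vec zhatA = S" "dim_vec zhatB = S"
    by (simp_all add: assms(9,10))
  \<comment> \<open>Entries are quotients of squares, hence nonnegative. Entropy is the negative of
    this sum, so the inequality reverses.\<close>
  have "(\<Sum>i<dim_vec zhatA. zhatA $ i * ln (zhatA $ i))
      < (\<Sum>i<dim_vec zhatB. zhatB $ i * ln (zhatB $ i))"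
    by (rule majorized_by_sum_x_ln_x_less[OF assms(11,12)]) (simp_all add: assms(9,10))
  then show ?thesis
    by (simp add: cond_scale_entropy_def dist dim)
qed

end
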